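(* Let $S$ be a semigroup and let $a\in S$. Let $P_1=\{x\in S: xa\mathrel{\mathscr R}x\}$, $P_2=\{x\in S: ax\mathrel{\mathscr L}x\}$ and $P=P_1\cap P_2$. Then for every $x\in S$: (i) $R_x^a=R_x\cap P_1$ if $x\in P_1$, and $R_x^a=\{x\}$ if $x\in S\setminus P_1$; (ii) $L_x^a=L_x\cap P_2$ if $x\in P_2$, and $L_x^a=\{x\}$ if $x\in S\setminus P_2$; (iii) $H_x^a=H_x$ if $x\in P$, and $H_x^a=\{x\}$ if $x\in S\setminus P$; (iv) $D_x^a=D_x\cap P$ if $x\in P$; $D_x^a=L_x^a$ if $x\in P_2\setminus P_1$; $D_x^a=R_x^a$ if $x\in P_1\setminus P_2$; and $D_x^a=\{x\}$ if $x\in S\setminus(P_1\cup P_2)$. Further, if $x\in S\setminus P$, then $H_x^a=\{x\}$ is a non-group $\mathscr H^a$-class of $S^a$.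
   Context: For a semigroup $S$ and $a\in S$, the variant $S^a$ is the semigroup with underlying set $S$ and operation $x\star y=xay$. For a semigroup $T$, $T^{(1)}$ is $T$ with an identity adjoined if necessary. Green's relations on $T$: $x\mathrel{\mathscr R}y\iff xT^{(1)}=yT^{(1)}$; $x\mathrel{\mathscr L}y\iff T^{(1)}x=T^{(1)}y$; $\mathscr H=\mathscr R\cap\mathscr L$; $\mathscr D=\mathscr R\circ\mathscr L=\mathscr L\circ\mathscr R$. The symbols $\mathscr R,\mathscr L,\mathscr H,\mathscr D$ denote Green's relations on $S$, and $R_x,L_x,H_x,D_x$ the corresponding classes of $x$ in $S$; $\mathscr R^a,\mathscr L^a,\mathscr H^a,\mathscr D^a$ denote Green's relations on $S^a$, and $R_x^a,L_x^a,H_x^a,D_x^a$ the corresponding classes of $x$ in $S^a$. An $\mathscr H^a$-class is a group class if it is a subgroup of $S^a$ (under $\star$), and a non-group class otherwise. *)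

theory Defs
  imports "HOL-Algebra.Group"
begin

text \<open>
  A semigroup is an associative operation \<open>f\<close> on a type, i.e. the library locale \<open>semigroup f\<close>
  of theory \<open>Groups\<close>. Green's relations take the operation as a parameter, so that they apply
  both to a semigroup and to its variants, which share the same underlying set.
\<close>

definition variant :: "('a \<Rightarrow> 'a \<Rightarrow> 'a) \<Rightarrow> 'a \<Rightarrow> 'a \<Rightarrow> 'a \<Rightarrow> 'a" where
  "variant f a x y = f (f x a) y"

lemma semigroup_variant:
  assumes "semigroup f"
  shows "semigroup (variant f a)"
  using assms unfolding semigroup_def variant_def by simp

text \<open>
  \<open>T\<^sup>(\<^sup>1\<^sup>)\<close> is modelled inside \<open>'a option\<close>: \<open>Some x\<close> stands for \<open>x\<close>, and \<open>None\<close> is the adjoined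
  identity, which belongs to the carrier only if the semigroup has no identity of its own.
  The qualified name refers to the locale of theory \<open>Groups\<close>, not the record-based one
  of \<open>HOL-Algebra\<close>.
\<close>

definition adjoin_one :: "('a \<Rightarrow> 'a \<Rightarrow> 'a) \<Rightarrow> 'a option set" where
  "adjoin_one f = (if \<exists>e. Groups.monoid f e then range Some else insert None (range Some))"

fun adjoin_mult :: "('a \<Rightarrow> 'a \<Rightarrow> 'a) \<Rightarrow> 'a option \<Rightarrow> 'a option \<Rightarrow> 'a option" where
  "adjoin_mult f None t = t"
| "adjoin_mult f s None = s"
| "adjoin_mult f (Some x) (Some y) = Some (f x y)"

definition greenR :: "('a \<Rightarrow> 'a \<Rightarrow> 'a) \<Rightarrow> 'a \<Rightarrow> 'a \<Rightarrow> bool" where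
  "greenR f x y \<longleftrightarrow>
    (\<lambda>t. adjoin_mult f (Some x) t) ` adjoin_one f = (\<lambda>t. adjoin_mult f (Some y) t) ` adjoin_one f"

definition greenL :: "('a \<Rightarrow> 'a \<Rightarrow> 'a) \<Rightarrow> 'a \<Rightarrow> 'a \<Rightarrow> bool" where
  "greenL f x y \<longleftrightarrow>
    (\<lambda>t. adjoin_mult f t (Some x)) ` adjoin_one f = (\<lambda>t. adjoin_mult f t (Some y)) ` adjoin_one f"

definition greenH :: "('a \<Rightarrow> 'a \<Rightarrow> 'a) \<Rightarrow> 'a \<Rightarrow> 'a \<Rightarrow> bool" where
  "greenH f x y \<longleftrightarrow> greenR f x y \<and> greenL f x y"

definition greenD :: "('a \<Rightarrow> 'a \<Rightarrow> 'a) \<Rightarrow> 'a \<Rightarrow> 'a \<Rightarrow> bool" where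
  "greenD f = greenR f OO greenL f"

definition R_class :: "('a \<Rightarrow> 'a \<Rightarrow> 'a) \<Rightarrow> 'a \<Rightarrow> 'a set" where
  "R_class f x = {y. greenR f x y}"

definition L_class :: "('a \<Rightarrow> 'a \<Rightarrow> 'a) \<Rightarrow> 'a \<Rightarrow> 'a set" where
  "L_class f x = {y. greenL f x y}"

definition H_class :: "('a \<Rightarrow> 'a \<Rightarrow> 'a) \<Rightarrow> 'a \<Rightarrow> 'a set" where
  "H_class f x = {y. greenH f x y}"

definition D_class :: "('a \<Rightarrow> 'a \<Rightarrow> 'a) \<Rightarrow> 'a \<Rightarrow> 'a set" where
  "D_class f x = {y. greenD f x y}"

text \<open>The order of the two factors in \<open>greenD\<close> is immaterial.\<close>

lemma adjoin_image_right:
  assumes "semigroup f"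
  shows "(\<lambda>t. adjoin_mult f (Some x) t) ` adjoin_one f = Some ` insert x (range (f x))"
proof (cases "\<exists>e. Groups.monoid f e")
  case True
  then obtain e where "Groups.monoid f e" by blast
  then have "f x e = x" by (rule Groups.monoid.right_neutral)
  then have "x \<in> range (f x)" by (metis rangeI)
  then have "insert x (range (f x)) = range (f x)" by blast
  with True show ?thesis by (simp add: adjoin_one_def image_image)
next
  case False
  then show ?thesis by (simp add: adjoin_one_def image_image)
qed

lemma adjoin_image_left:
  assumes "semigroup f"
  shows "(\<lambda>t. adjoin_mult f t (Some x)) ` adjoin_one f = Some ` insert x (range (\<lambda>u. f u x))"
proof (cases "\<exists>e. Groups.monoid f e")
  case True
  then obtain e where "Groups.monoid f e" by blast
  then have "f e x = x" by (rule Groups.monoid.left_neutral)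
  then have "x \<in> range (\<lambda>u. f u x)" by (metis rangeI)
  then have "insert x (range (\<lambda>u. f u x)) = range (\<lambda>u. f u x)" by blast
  with True show ?thesis by (simp add: adjoin_one_def image_image)
next
  case False
  then show ?thesis by (simp add: adjoin_one_def image_image)
qed

lemma greenR_iff:
  assumes "semigroup f"
  shows "greenR f x y \<longleftrightarrow> x = y \<or> (\<exists>u v. x = f y u \<and> y = f x v)"
proof -
  have sub: "insert z (range (f z)) \<subseteq> insert w (range (f w))" if "z = f w u" for z w u
    using that semigroup.assoc[OF assms, of w u] by auto
  have "greenR f x y \<longleftrightarrow> insert x (range (f x)) = insert y (range (f y))"
    unfolding greenR_def adjoin_image_right[OF assms] by (rule inj_image_eq_iff) simp
  also have "\<dots> \<longleftrightarrow> x = y \<or> (\<exists>u v. x = f y u \<and> y = f x v)"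
  proof
    assume eq: "insert x (range (f x)) = insert y (range (f y))"
    have "x \<in> insert y (range (f y))" "y \<in> insert x (range (f x))"
      using eq[symmetric] by (metis insertI1)+
    then show "x = y \<or> (\<exists>u v. x = f y u \<and> y = f x v)" by (metis insertE rangeE)
  next
    assume "x = y \<or> (\<exists>u v. x = f y u \<and> y = f x v)"
    then show "insert x (range (f x)) = insert y (range (f y))"
    proof
      assume "\<exists>u v. x = f y u \<and> y = f x v"
      then obtain u v where "x = f y u" "y = f x v" by blast
      then show ?thesis using sub by (intro subset_antisym)
    qed simp
  qed
  finally show ?thesis .
qed

lemma greenL_iff:
  assumes "semigroup f"
  shows "greenL f x y \<longleftrightarrow> x = y \<or> (\<exists>u v. x = f u y \<and> y = f v x)"
proof -
  have sub: "insert z (range (\<lambda>t. f t z)) \<subseteq> insert w (range (\<lambda>t. f t w))" if "z = f u w" for z w u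
    using that semigroup.assoc[OF assms, of _ u w, symmetric] by auto
  have "greenL f x y \<longleftrightarrow> insert x (range (\<lambda>u. f u x)) = insert y (range (\<lambda>u. f u y))"
    unfolding greenL_def adjoin_image_left[OF assms] by (rule inj_image_eq_iff) simp
  also have "\<dots> \<longleftrightarrow> x = y \<or> (\<exists>u v. x = f u y \<and> y = f v x)"
  proof
    assume eq: "insert x (range (\<lambda>u. f u x)) = insert y (range (\<lambda>u. f u y))"
    have "x \<in> insert y (range (\<lambda>u. f u y))" "y \<in> insert x (range (\<lambda>u. f u x))"
      using eq[symmetric] by (metis insertI1)+
    then show "x = y \<or> (\<exists>u v. x = f u y \<and> y = f v x)" by (metis insertE rangeE)
  next
    assume "x = y \<or> (\<exists>u v. x = f u y \<and> y = f v x)"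
    then show "insert x (range (\<lambda>u. f u x)) = insert y (range (\<lambda>u. f u y))"
    proof
      assume "\<exists>u v. x = f u y \<and> y = f v x"
      then obtain u v where "x = f u y" "y = f v x" by blast
      then show ?thesis using sub by (intro subset_antisym)
    qed simp
  qed
  finally show ?thesis .
qed

lemma greenD_commute:
  assumes "semigroup f"
  shows "greenD f = greenL f OO greenR f"
proof -
  note assoc = semigroup.assoc[OF assms]
  have swap: "\<exists>w. greenL f x w \<and> greenR f w y" if xz: "greenR f x z" and zy: "greenL f z y" for x y z
  proof (cases "x = z \<or> z = y")
    case True
    with that show ?thesis by (auto simp: greenR_def greenL_def)
  next
    case False
    with that obtain u v s t where *: "x = f z u" "z = f x v" "z = f s y" "y = f t z"
      unfolding greenR_iff[OF assms] greenL_iff[OF assms] by blast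
    have "x = f s (f y u)" using *(1,3) by (simp add: assoc)
    moreover have "f y u = f t x" using *(1,4) by (simp add: assoc)
    moreover have "y = f (f y u) v"
      using *(2,4) \<open>f y u = f t x\<close> by (simp add: assoc)
    ultimately show ?thesis
      unfolding greenR_iff[OF assms] greenL_iff[OF assms] by blast
  qed
  have swap': "\<exists>w. greenR f x w \<and> greenL f w y" if xz: "greenL f x z" and zy: "greenR f z y" for x y z
  proof -
    have "greenR f y z" "greenL f z x"
      using that by (simp_all add: greenR_def greenL_def)
    then obtain w where "greenL f y w" "greenR f w x" using swap by blast
    then have "greenR f x w" "greenL f w y" by (simp_all add: greenR_def greenL_def)
    then show ?thesis by blast
  qed
  show ?thesis unfolding greenD_def using swap swap' by (intro ext) blast
qed

definition var_P1 :: "('a \<Rightarrow> 'a \<Rightarrow> 'a) \<Rightarrow> 'a \<Rightarrow> 'a set" where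
  "var_P1 f a = {x. greenR f (f x a) x}"

definition var_P2 :: "('a \<Rightarrow> 'a \<Rightarrow> 'a) \<Rightarrow> 'a \<Rightarrow> 'a set" where
  "var_P2 f a = {x. greenL f (f a x) x}"

definition var_P :: "('a \<Rightarrow> 'a \<Rightarrow> 'a) \<Rightarrow> 'a \<Rightarrow> 'a set" where
  "var_P f a = var_P1 f a \<inter> var_P2 f a"

definition is_subgroup :: "('a \<Rightarrow> 'a \<Rightarrow> 'a) \<Rightarrow> 'a set \<Rightarrow> bool" where
  "is_subgroup f X \<longleftrightarrow> (\<exists>e. Group.group \<lparr>carrier = X, mult = f, one = e\<rparr>)"

definition non_group_H_class :: "('a \<Rightarrow> 'a \<Rightarrow> 'a) \<Rightarrow> 'a set \<Rightarrow> bool" where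
  "non_group_H_class f X \<longleftrightarrow> X \<in> range (H_class f) \<and> \<not> is_subgroup f X"

end

theory Submission
  imports Defs
begin

text \<open>
  Membership in \<open>P\<^sub>1\<close> means that \<open>x \<in> x a S\<close>. Two distinct elements that are \<open>\<R>\<close>-related in
  \<open>S\<^sup>a\<close>, say \<open>x = y a u\<close> and \<open>y = x a v\<close>, satisfy \<open>x = x a (v a u)\<close>, so they lie in \<open>P\<^sub>1\<close>.
  Conversely, if \<open>y = y a u\<close>, then any multiple \<open>y s\<close> equals \<open>y a (u s)\<close> and is therefore a
  multiple of \<open>y\<close> in \<open>S\<^sup>a\<close>. Hence \<open>\<R>\<^sup>a\<close> is the union of the equality relation and the
  restriction of \<open>\<R>\<close> to \<open>P\<^sub>1\<close> (lemma \<open>greenR_variant_iff\<close>). The corresponding statement on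
  \<open>\<L>\<^sup>a\<close> and \<open>P\<^sub>2\<close> is the same one in the opposite semigroup.

  For \<open>\<H>\<^sup>a\<close> and \<open>\<D>\<^sup>a\<close> one needs further that \<open>x = x a u\<close> implies \<open>v x = (v x) a u\<close>: the set
  \<open>P\<^sub>1\<close> is a union of \<open>\<L>\<close>-classes and, dually, \<open>P\<^sub>2\<close> is a union of \<open>\<R>\<close>-classes. Thus, if \<open>x\<close>
  and \<open>y\<close> lie in \<open>P\<close>, an element \<open>z\<close> with \<open>x \<R> z \<L> y\<close> also lies in \<open>P\<close>. Finally, a one-element
  subgroup \<open>{x}\<close> of \<open>S\<^sup>a\<close> forces \<open>x = x a x\<close>, whence \<open>x \<in> P\<close>.
\<close>

lemma semigroup_opposite:
  assumes "semigroup f"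
  shows "semigroup (\<lambda>x y. f y x)"
  using assms unfolding semigroup_def by simp

lemma greenL_eq_greenR_opposite:
  assumes "semigroup f"
  shows "greenL f = greenR (\<lambda>x y. f y x)"
  by (intro ext) (simp add: greenL_iff[OF assms] greenR_iff[OF semigroup_opposite[OF assms]])

lemma variant_opposite:
  assumes "semigroup f"
  shows "variant (\<lambda>x y. f y x) a = (\<lambda>x y. variant f a y x)"
  by (intro ext) (simp add: variant_def semigroup.assoc[OF assms])

lemma var_P2_eq_var_P1_opposite:
  assumes "semigroup f"
  shows "var_P2 f a = var_P1 (\<lambda>x y. f y x) a"
  by (simp add: var_P1_def var_P2_def greenL_eq_greenR_opposite[OF assms])

lemma greenR_refl: "greenR f x x"
  by (simp add: greenR_def)

lemma greenL_refl: "greenL f x x"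
  by (simp add: greenL_def)

lemma var_P1_iff:
  assumes "semigroup f"
  shows "x \<in> var_P1 f a \<longleftrightarrow> (\<exists>u. x = f (f x a) u)"
proof -
  \<comment> \<open>If \<open>x a\<close> and \<open>x\<close> are related merely by being equal, then \<open>u = a\<close> serves.\<close>
  have "x = f (f x a) a" if "f x a = x"
    using that by simp
  then show ?thesis
    unfolding var_P1_def greenR_iff[OF assms] by blast
qed

lemma var_P2_iff:
  assumes "semigroup f"
  shows "x \<in> var_P2 f a \<longleftrightarrow> (\<exists>u. x = f u (f a x))"
  using var_P1_iff[OF semigroup_opposite[OF assms], of x a]
  by (simp add: var_P2_eq_var_P1_opposite[OF assms])

lemma greenR_variant_iff:
  assumes "semigroup f"
  shows "greenR (variant f a) x y \<longleftrightarrow>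
    x = y \<or> (x \<in> var_P1 f a \<and> y \<in> var_P1 f a \<and> greenR f x y)"
proof -
  note assoc = semigroup.assoc[OF assms]
  note iff = greenR_iff[OF assms] greenR_iff[OF semigroup_variant[OF assms]] variant_def
  have memb: "x \<in> var_P1 f a" if "x = f (f y a) u" "y = f (f x a) v" for x y u v
  proof -
    have "x = f (f x a) (f (f v a) u)"
      using that by (metis assoc)
    then show ?thesis
      unfolding var_P1_iff[OF assms] by blast
  qed
  have mult: "\<exists>t. f y s = f (f y a) t" if "y \<in> var_P1 f a" for y s
    using that unfolding var_P1_iff[OF assms] by (metis assoc)
  show ?thesis
  proof
    assume "greenR (variant f a) x y"
    then consider "x = y" | u v where "x = f (f y a) u" "y = f (f x a) v"
      unfolding iff by blast
    then show "x = y \<or> (x \<in> var_P1 f a \<and> y \<in> var_P1 f a \<and> greenR f x y)"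
    proof cases
      case 2
      have "x = f y (f a u)" "y = f x (f a v)"
        using 2 by (simp_all flip: assoc)
      then have "greenR f x y"
        unfolding iff by blast
      with memb[OF 2] memb[OF 2(2,1)] show ?thesis
        by blast
    qed simp
  next
    assume "x = y \<or> (x \<in> var_P1 f a \<and> y \<in> var_P1 f a \<and> greenR f x y)"
    then show "greenR (variant f a) x y"
      unfolding iff using mult by metis
  qed
qed

lemma greenL_variant_iff:
  assumes "semigroup f"
  shows "greenL (variant f a) x y \<longleftrightarrow>
    x = y \<or> (x \<in> var_P2 f a \<and> y \<in> var_P2 f a \<and> greenL f x y)"
  using greenR_variant_iff[OF semigroup_opposite[OF assms], of a x y]
  by (simp add: greenL_eq_greenR_opposite[OF assms] variant_opposite[OF assms]
      greenL_eq_greenR_opposite[OF semigroup_variant[OF assms]]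
      var_P2_eq_var_P1_opposite[OF assms])

lemma var_P1_greenL_closed:
  assumes "semigroup f" "greenL f x y"
  shows "x \<in> var_P1 f a \<longleftrightarrow> y \<in> var_P1 f a"
proof -
  have "f v z \<in> var_P1 f a" if "z \<in> var_P1 f a" for v z
    using that unfolding var_P1_iff[OF assms(1)] by (metis semigroup.assoc[OF assms(1)])
  then show ?thesis
    using assms(2) unfolding greenL_iff[OF assms(1)] by metis
qed

lemma var_P2_greenR_closed:
  assumes "semigroup f" "greenR f x y"
  shows "x \<in> var_P2 f a \<longleftrightarrow> y \<in> var_P2 f a"
  using var_P1_greenL_closed[OF semigroup_opposite[OF assms(1)], of x y a] assms
  by (simp add: greenL_eq_greenR_opposite[OF semigroup_opposite[OF assms(1)]]
      var_P2_eq_var_P1_opposite[OF assms(1)])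

lemma greenD_variant_iff:
  assumes "semigroup f" "x \<in> var_P f a"
  shows "greenD (variant f a) x y \<longleftrightarrow> y \<in> var_P f a \<and> greenD f x y"
proof
  assume "greenD (variant f a) x y"
  then obtain z where z: "greenR (variant f a) x z" "greenL (variant f a) z y"
    unfolding greenD_def by blast
  have R: "greenR f x z" "z \<in> var_P1 f a"
    using z(1) assms(2) by (auto simp: greenR_variant_iff[OF assms(1)] var_P_def greenR_refl)
  have "z \<in> var_P2 f a"
    using var_P2_greenR_closed[OF assms(1) R(1)] assms(2) by (simp add: var_P_def)
  then have L: "greenL f z y" "y \<in> var_P2 f a"
    using z(2) by (auto simp: greenL_variant_iff[OF assms(1)] greenL_refl)
  have "y \<in> var_P1 f a"
    using var_P1_greenL_closed[OF assms(1) L(1)] R(2) by simp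
  with R(1) L show "y \<in> var_P f a \<and> greenD f x y"
    unfolding var_P_def greenD_def by blast
next
  assume y: "y \<in> var_P f a \<and> greenD f x y"
  then obtain z where z: "greenR f x z" "greenL f z y"
    unfolding greenD_def by blast
  have "z \<in> var_P2 f a" "z \<in> var_P1 f a"
    using var_P2_greenR_closed[OF assms(1) z(1)] var_P1_greenL_closed[OF assms(1) z(2)] assms(2) y
    by (simp_all add: var_P_def)
  with z y assms(2) have "greenR (variant f a) x z" "greenL (variant f a) z y"
    by (auto simp: greenR_variant_iff[OF assms(1)] greenL_variant_iff[OF assms(1)] var_P_def)
  then show "greenD (variant f a) x y"
    unfolding greenD_def by blast
qed

lemma singleton_subgroup_variant_in_var_P:
  assumes "semigroup f" "is_subgroup (variant f a) {x}"
  shows "x \<in> var_P f a"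
proof -
  obtain e where "Group.group \<lparr>carrier = {x}, mult = variant f a, one = e\<rparr>"
    using assms(2) unfolding is_subgroup_def by blast
  then interpret G: Group.group "\<lparr>carrier = {x}, mult = variant f a, one = e\<rparr>" .
  \<comment> \<open>Closure of \<open>{x}\<close> under the operation suffices.\<close>
  have "f (f x a) x = x"
    using G.m_closed[of x x] by (simp add: variant_def)
  moreover from this have "f x (f a x) = x"
    by (simp add: semigroup.assoc[OF assms(1)])
  ultimately show ?thesis
    unfolding var_P_def Int_iff var_P1_iff[OF assms(1)] var_P2_iff[OF assms(1)] by metis
qed

theorem proposition3p2:
  fixes f :: "'a \<Rightarrow> 'a \<Rightarrow> 'a" and a :: 'a
  assumes "semigroup f"
  shows "\<forall>x.
    (x \<in> var_P1 f a \<longrightarrow> R_class (variant f a) x = R_class f x \<inter> var_P1 f a) \<and>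
    (x \<notin> var_P1 f a \<longrightarrow> R_class (variant f a) x = {x}) \<and>
    (x \<in> var_P2 f a \<longrightarrow> L_class (variant f a) x = L_class f x \<inter> var_P2 f a) \<and>
    (x \<notin> var_P2 f a \<longrightarrow> L_class (variant f a) x = {x}) \<and>
    (x \<in> var_P f a \<longrightarrow> H_class (variant f a) x = H_class f x) \<and>
    (x \<notin> var_P f a \<longrightarrow> H_class (variant f a) x = {x}) \<and>
    (x \<in> var_P f a \<longrightarrow> D_class (variant f a) x = D_class f x \<inter> var_P f a) \<and>
    (x \<in> var_P2 f a - var_P1 f a \<longrightarrow> D_class (variant f a) x = L_class (variant f a) x) \<and>
    (x \<in> var_P1 f a - var_P2 f a \<longrightarrow> D_class (variant f a) x = R_class (variant f a) x) \<and>
    (x \<notin> var_P1 f a \<union> var_P2 f a \<longrightarrow> D_class (variant f a) x = {x}) \<and>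
    (x \<notin> var_P f a \<longrightarrow> H_class (variant f a) x = {x} \<and>
       non_group_H_class (variant f a) (H_class (variant f a) x))"
proof (intro allI)
  fix x
  note sv = semigroup_variant[OF assms, of a]
  note R = greenR_variant_iff[OF assms, of a]
  note L = greenL_variant_iff[OF assms, of a]
  have R_in: "R_class (variant f a) x = R_class f x \<inter> var_P1 f a" if "x \<in> var_P1 f a"
    using that by (auto simp: R_class_def R greenR_refl)
  have R_out: "R_class (variant f a) x = {x}" if "x \<notin> var_P1 f a"
    using that by (auto simp: R_class_def R)
  have L_in: "L_class (variant f a) x = L_class f x \<inter> var_P2 f a" if "x \<in> var_P2 f a"
    using that by (auto simp: L_class_def L greenL_refl)
  have L_out: "L_class (variant f a) x = {x}" if "x \<notin> var_P2 f a"
    using that by (auto simp: L_class_def L)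
  have H_in: "H_class (variant f a) x = H_class f x" if "x \<in> var_P f a"
  proof -
    have "greenH (variant f a) x y \<longleftrightarrow> greenH f x y" for y
      unfolding greenH_def R L
      using that var_P2_greenR_closed[OF assms, of x y a] var_P1_greenL_closed[OF assms, of x y a]
        greenR_refl[of f x] greenL_refl[of f x]
      unfolding var_P_def by blast
    then show ?thesis
      by (simp add: H_class_def)
  qed
  have H_out: "H_class (variant f a) x = {x}" if "x \<notin> var_P f a"
    using that by (auto simp: H_class_def greenH_def R L var_P_def)
  have D_in: "D_class (variant f a) x = D_class f x \<inter> var_P f a" if "x \<in> var_P f a"
    using greenD_variant_iff[OF assms that] by (auto simp: D_class_def)
  have D_L: "D_class (variant f a) x = L_class (variant f a) x" if "x \<notin> var_P1 f a"
    using that by (auto simp: D_class_def L_class_def greenD_def R)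
  \<comment> \<open>Here the \<open>\<L>\<close>-step is the trivial one, so the composition is taken in the other order.\<close>
  have D_R: "D_class (variant f a) x = R_class (variant f a) x" if "x \<notin> var_P2 f a"
    using that by (auto simp: D_class_def R_class_def greenD_commute[OF sv] L)
  have "non_group_H_class (variant f a) (H_class (variant f a) x)" if "x \<notin> var_P f a"
    using singleton_subgroup_variant_in_var_P[OF assms] that H_out[OF that]
    unfolding non_group_H_class_def by auto
  with R_in R_out L_in L_out H_in H_out D_in D_L D_R
  show "(x \<in> var_P1 f a \<longrightarrow> R_class (variant f a) x = R_class f x \<inter> var_P1 f a) \<and>
    (x \<notin> var_P1 f a \<longrightarrow> R_class (variant f a) x = {x}) \<and>
    (x \<in> var_P2 f a \<longrightarrow> L_class (variant f a) x = L_class f x \<inter> var_P2 f a) \<and>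
    (x \<notin> var_P2 f a \<longrightarrow> L_class (variant f a) x = {x}) \<and>
    (x \<in> var_P f a \<longrightarrow> H_class (variant f a) x = H_class f x) \<and>
    (x \<notin> var_P f a \<longrightarrow> H_class (variant f a) x = {x}) \<and>
    (x \<in> var_P f a \<longrightarrow> D_class (variant f a) x = D_class f x \<inter> var_P f a) \<and>
    (x \<in> var_P2 f a - var_P1 f a \<longrightarrow> D_class (variant f a) x = L_class (variant f a) x) \<and>
    (x \<in> var_P1 f a - var_P2 f a \<longrightarrow> D_class (variant f a) x = R_class (variant f a) x) \<and>
    (x \<notin> var_P1 f a \<union> var_P2 f a \<longrightarrow> D_class (variant f a) x = {x}) \<and>
    (x \<notin> var_P f a \<longrightarrow> H_class (variant f a) x = {x} \<and>
       non_group_H_class (variant f a) (H_class (variant f a) x))"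
    by (intro conjI impI) simp_all
qed

end
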